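(* Let $X$ be a compact metric space, let $A_1, A_2 \subset C(X)$ be closed subalgebras containing the constant functions, and suppose that $A_1 + A_2$ is proximinal in $C(X)$. Then for every $f \in C(X) \setminus (A_1 + A_2)$, $$E(f) = \sup_{l \subset X} |r_l(f)|,$$ where the supremum is taken over all closed bolts $l$ with respect to $A_1$ and $A_2$.
   Context: $C(X)$ is the space of real-valued continuous functions on $X$ with the max-norm $\|\cdot\|$; closedness of subalgebras is with respect to this norm. $A_1 + A_2 = \{u_1 + u_2 : u_1 \in A_1,\ u_2 \in A_2\}$. The approximation error is $E(f) = \inf_{u \in A_1 + A_2} \|f - u\|$. A subspace $F$ of a normed linear space $E$ is proximinal in $E$ if for every $e \in E$ there exists at least one $f_0 \in F$ with $\|e - f_0\| = \inf_{g \in F} \|e - g\|$. For $i=1,2$ define the equivalence relation $R_i$ on $X$ by: $a \overset{R_i}{\sim} b$ if $g(a) = g(b)$ for all $g \in A_i$. Let $X_i = X/R_i$ be the quotient spaces, and let $s : X \to X_1$ and $p : X \to X_2$ be the natural projections. Thus $s(a) = s(b)$ iff $g(a)=g(b)$ for all $g \in A_1$, and $p(a) = p(b)$ iff $g(a)=g(b)$ for all $g \in A_2$. A bolt (lightning bolt with respect to $A_1$ and $A_2$) is a finite or infinite ordered sequence $\{x_1, x_2, \dots\}$ of points of $X$ (points may repeat), with $x_i \ne x_{i+1}$ for all $i$, such that either $s(x_1) = s(x_2),\ p(x_2) = p(x_3),\ s(x_3) = s(x_4), \dots$ or $p(x_1) = p(x_2),\ s(x_2) = s(x_3),\ p(x_3)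 = p(x_4), \dots$. If $\{x_1, \dots, x_n, x_{n+1}\}$ is a finite bolt with $x_{n+1} = x_1$ and $n$ even, then $\{x_1, \dots, x_n\}$ is called a closed bolt. With each finite bolt $l = \{x_1, \dots, x_n\}$ one associates the bolt functional $r_l : C(X) \to \mathbb{R}$, $$r_l(F) = \frac{1}{n} \sum_{i=1}^n (-1)^{i+1} F(x_i).$$ *)

theory Defs
  imports "HOL-Analysis.Analysis"
begin

text \<open>
  For a compact metric space \<open>X\<close>, given as a type \<open>'a\<close> with \<open>compact (UNIV :: 'a set)\<close>, the
  space \<open>C(X)\<close> with the max-norm is the type \<open>'a \<Rightarrow>\<^sub>C real\<close> with its library norm.
\<close>

definition subalgebra_with_constants :: "('a::topological_space \<Rightarrow>\<^sub>C real) set \<Rightarrow> bool" where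
  "subalgebra_with_constants A \<longleftrightarrow>
     subspace A \<and>
     (\<forall>f\<in>A. \<forall>g\<in>A. \<exists>h\<in>A. \<forall>x. apply_bcontfun h x = apply_bcontfun f x * apply_bcontfun g x) \<and>
     (\<forall>c. const_bcontfun c \<in> A)"

definition approx_error :: "'e::real_normed_vector set \<Rightarrow> 'e \<Rightarrow> real" where
  "approx_error F e = (INF g\<in>F. norm (e - g))"

definition proximinal :: "'e::real_normed_vector set \<Rightarrow> bool" where
  "proximinal F \<longleftrightarrow> subspace F \<and> (\<forall>e. \<exists>f0\<in>F. norm (e - f0) = (INF g\<in>F. norm (e - g)))"

definition alg_rel :: "('a::topological_space \<Rightarrow>\<^sub>C real) set \<Rightarrow> ('a \<times> 'a) set" where
  "alg_rel A = {(a, b). \<forall>g\<in>A. apply_bcontfun g a = apply_bcontfun g b}"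

text \<open>The natural projection of \<open>X\<close> onto the quotient \<open>UNIV // alg_rel A\<close>.\<close>

definition quot_proj :: "('a::topological_space \<Rightarrow>\<^sub>C real) set \<Rightarrow> 'a \<Rightarrow> 'a set" where
  "quot_proj A = Equiv_Relations.proj (alg_rel A)"

text \<open>
  Finite sequences of points are lists, indexed from \<open>0\<close>: the point written \<open>x\<^sub>i\<close> in
  mathematical notation is \<open>xs ! (i - 1)\<close>. Points may repeat.
\<close>

definition alternates :: "('a \<Rightarrow> 'b) \<Rightarrow> ('a \<Rightarrow> 'b) \<Rightarrow> 'a list \<Rightarrow> bool" where
  "alternates s p xs \<longleftrightarrow>
     (\<forall>i. Suc i < length xs \<longrightarrow>
        (if even i then s (xs ! i) = s (xs ! Suc i) else p (xs ! i) = p (xs ! Suc i)))"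

definition finite_bolt ::
  "('a::topological_space \<Rightarrow>\<^sub>C real) set \<Rightarrow> ('a \<Rightarrow>\<^sub>C real) set \<Rightarrow> 'a list \<Rightarrow> bool" where
  "finite_bolt A1 A2 xs \<longleftrightarrow>
     xs \<noteq> [] \<and>
     (\<forall>i. Suc i < length xs \<longrightarrow> xs ! i \<noteq> xs ! Suc i) \<and>
     (alternates (quot_proj A1) (quot_proj A2) xs \<or> alternates (quot_proj A2) (quot_proj A1) xs)"

definition closed_bolt ::
  "('a::topological_space \<Rightarrow>\<^sub>C real) set \<Rightarrow> ('a \<Rightarrow>\<^sub>C real) set \<Rightarrow> 'a list \<Rightarrow> bool" where
  "closed_bolt A1 A2 xs \<longleftrightarrow>
     xs \<noteq> [] \<and> even (length xs) \<and> finite_bolt A1 A2 (xs @ [hd xs])"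

definition bolt_functional :: "'a list \<Rightarrow> ('a::topological_space \<Rightarrow>\<^sub>C real) \<Rightarrow> real" where
  "bolt_functional xs F =
     1 / real (length xs) * (\<Sum>i<length xs. (- 1) ^ i * apply_bcontfun F (xs ! i))"

end

theory Submission
  imports Defs
begin

text \<open>
  Closed bolts annihilate the sum \<open>S\<close> of the algebras and bolt functionals have norm at most one, so each
  of them bounds the error from below. For the converse, suppose that the functionals of all closed
  bolts are at most \<open>\<sigma>\<close> in absolute value at \<open>f\<close>. The proof combines a duality with a geometric property
  of closed sums.
  
  Duality (\<open>alternating_potentials\<close>): if costs attached to the successive points of alternating
  sequences of fixed length always have a negative total, then they are dominated by differences of
  continuous potentials taken alternately from the two algebras. This is the existence of potentials in
  the absence of expensive paths, made continuous by an insertion theorem (\<open>lattice_insertion\<close>) for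
  closed algebras. For the costs \<open>f - \<sigma>, - f - \<sigma>, f - \<sigma>, \<dots>\<close> the averaged potentials yield an element
  of \<open>S\<close> within \<open>\<sigma>\<close> of \<open>f\<close> (\<open>approx_error_le_alternating_average\<close>). The error is therefore controlled by
  averages over long alternating sequences that need not be closed.
  
  Geometry: a proximinal subspace is closed. As \<open>S\<close> is closed, the uniform boundedness principle shows
  that, for \<open>u1 + u2\<close> of norm at most one, the values of \<open>u2\<close> at the ends of an alternating sequence with
  first and last step in \<open>alg_rel A1\<close> differ by at most a constant independent of the sequence. The same duality produces functions in
  \<open>S\<close> that violate this bound when two points are only connected by very long sequences. Hence points
  that are connected at all are connected by a sequence of bounded length (\<open>alternating_exchange\<close>,
  \<open>alternating_shorten\<close>).
  
  A long alternating sequence can thus be closed at bounded cost, and its average is at most slightly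
  larger than \<open>\<sigma>\<close>. Repeated points in the closed sequence cancel, which leaves a closed bolt
  or nothing
  (\<open>closed_alternating_sum_bound\<close>).
\<close>

section \<open>Lattices of continuous functions\<close>

text \<open>
  Vector lattices of continuous functions containing the constants. They are sets of plain functions
  rather than elements of the type of bounded continuous functions, so that maxima, sums and scalar
  multiples can be written pointwise.
\<close>

definition continuous_lattice :: "('a::topological_space \<Rightarrow> real) set \<Rightarrow> bool" where
  "continuous_lattice F \<longleftrightarrow>
     (\<forall>f\<in>F. continuous_on UNIV f) \<and> (\<forall>c. (\<lambda>_. c) \<in> F) \<and>
     (\<forall>f\<in>F. \<forall>g\<in>F. (\<lambda>x. f x + g x) \<in> F) \<and> (\<forall>c. \<forall>f\<in>F. (\<lambda>x. c * f x) \<in> F) \<and>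
     (\<forall>f\<in>F. \<forall>g\<in>F. (\<lambda>x. max (f x) (g x)) \<in> F)"

text \<open>
  Two points are related when no function in \<open>F\<close> separates them. A function in \<open>F\<close> is thus a function
  on the quotient by this relation.
\<close>

definition fun_rel :: "('a \<Rightarrow> real) set \<Rightarrow> ('a \<times> 'a) set" where
  "fun_rel F = {(a, b). \<forall>g\<in>F. g a = g b}"

lemma fun_rel_refl [simp]: "(a, a) \<in> fun_rel F"
  by (simp add: fun_rel_def)

lemma fun_rel_sym: "(a, b) \<in> fun_rel F \<Longrightarrow> (b, a) \<in> fun_rel F"
  by (auto simp: fun_rel_def)

lemma fun_rel_eq: "(a, b) \<in> fun_rel F \<Longrightarrow> g \<in> F \<Longrightarrow> g a = g b"
  by (auto simp: fun_rel_def)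

context
  fixes F :: "('a::topological_space \<Rightarrow> real) set"
  assumes F: "continuous_lattice F"
begin

lemma lattice_continuous: "f \<in> F \<Longrightarrow> continuous_on UNIV f"
  using F by (simp add: continuous_lattice_def)

lemma lattice_const: "(\<lambda>_. c) \<in> F"
  using F by (simp add: continuous_lattice_def)

lemma lattice_add: "f \<in> F \<Longrightarrow> g \<in> F \<Longrightarrow> (\<lambda>x. f x + g x) \<in> F"
  using F by (simp add: continuous_lattice_def)

lemma lattice_scale: "f \<in> F \<Longrightarrow> (\<lambda>x. c * f x) \<in> F"
  using F by (simp add: continuous_lattice_def)

lemma lattice_max: "f \<in> F \<Longrightarrow> g \<in> F \<Longrightarrow> (\<lambda>x. max (f x) (g x)) \<in> F"
  using F by (simp add: continuous_lattice_def)

lemma lattice_min: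
  assumes "f \<in> F" "g \<in> F"
  shows "(\<lambda>x. min (f x) (g x)) \<in> F"
proof -
  have "(\<lambda>x. (-1) * max ((-1) * f x) ((-1) * g x)) \<in> F"
    by (intro lattice_scale lattice_max assms)
  moreover have "(\<lambda>x. (-1) * max ((-1) * f x) ((-1) * g x)) = (\<lambda>x. min (f x) (g x))"
    by (auto simp: max_def min_def)
  ultimately show ?thesis by simp
qed

lemma lattice_sum: "finite I \<Longrightarrow> (\<And>i. i \<in> I \<Longrightarrow> f i \<in> F) \<Longrightarrow> (\<lambda>x. \<Sum>i\<in>I. f i x) \<in> F"
  by (induction I rule: finite_induct) (auto intro: lattice_const lattice_add)

lemma lattice_Max:
  "finite I \<Longrightarrow> I \<noteq> {} \<Longrightarrow> (\<And>i. i \<in> I \<Longrightarrow> f i \<in> F) \<Longrightarrow> (\<lambda>x. Max ((\<lambda>i. f i x) ` I)) \<in> F"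
  by (induction I rule: finite_ne_induct) (auto intro: lattice_max)

lemma lattice_Min:
  "finite I \<Longrightarrow> I \<noteq> {} \<Longrightarrow> (\<And>i. i \<in> I \<Longrightarrow> f i \<in> F) \<Longrightarrow> (\<lambda>x. Min ((\<lambda>i. f i x) ` I)) \<in> F"
  by (induction I rule: finite_ne_induct) (auto intro: lattice_min)

lemma lattice_interpolate:
  assumes "(a, b) \<notin> fun_rel F"
  obtains g where "g \<in> F" "g a = \<alpha>" "g b = \<beta>"
proof -
  obtain h where h: "h \<in> F" "h a \<noteq> h b"
    using assms by (auto simp: fun_rel_def)
  define k where "k = (\<beta> - \<alpha>) / (h b - h a)"
  have "(\<lambda>x. k * h x + (\<alpha> - k * h a)) \<in> F"
    by (intro lattice_add lattice_scale lattice_const h)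
  moreover have "k * h b + (\<alpha> - k * h a) = \<beta>"
  proof -
    have "k * (h b - h a) = \<beta> - \<alpha>" using h by (simp add: k_def)
    then show ?thesis by (simp add: algebra_simps)
  qed
  ultimately show ?thesis using that[of "\<lambda>x. k * h x + (\<alpha> - k * h a)"] by simp
qed

end

text \<open>
  The finite cover property, phrased for a neighbourhood \<open>{y. P x y}\<close> of each point \<open>x\<close>.
\<close>

lemma compact_UNIV_finite_cover:
  assumes "compact (UNIV :: 'a::topological_space set)"
    and "\<And>x::'a. open {y. P x y}" "\<And>x. P x x"
  shows "\<exists>I. finite I \<and> I \<noteq> {} \<and> (\<forall>y. \<exists>x\<in>I. P x y)"
proof -
  have "UNIV \<subseteq> (\<Union>x\<in>UNIV. {y. P x y})" using assms(3) by auto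
  then obtain I where I: "finite I" "UNIV \<subseteq> (\<Union>x\<in>I. {y. P x y})"
    using compactE_image[OF assms(1), of UNIV "\<lambda>x. {y. P x y}"] assms(2) by metis
  then show ?thesis by (intro exI[of _ I]) auto
qed

lemma closed_fun_rel_class:
  assumes "continuous_lattice F"
  shows "closed {b. (a, b) \<in> fun_rel F}"
proof -
  have "{b. (a, b) \<in> fun_rel F} = (\<Inter>g\<in>F. {b. g a = g b})"
    by (auto simp: fun_rel_def)
  moreover have "closed {b. g a = g b}" if "g \<in> F" for g
    by (intro closed_Collect_eq lattice_continuous[OF assms that] continuous_on_const)
  ultimately show ?thesis by (simp add: closed_INT)
qed

text \<open>
  An insertion theorem in the style of Katetov and Tong for functions on a quotient space: a member of
  the lattice fits strictly between the upper semicontinuous \<open>q\<close> and the continuous \<open>U\<close> as soon as the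
  largest value of \<open>q\<close> on a class is below the least value of \<open>U\<close> on it. Neither function has to be
  constant on classes. Semicontinuity of \<open>q\<close> is stated as openness of \<open>{x. q x < g x}\<close> for every
  continuous \<open>g\<close>. The proof is the double compactness argument of the lattice form of the
  Stone--Weierstrass theorem.
\<close>

lemma lattice_insertion:
  fixes F :: "('a::topological_space \<Rightarrow> real) set"
  assumes comp: "compact (UNIV :: 'a set)"
    and F: "continuous_lattice F"
    and q: "\<And>g. continuous_on UNIV g \<Longrightarrow> open {x. q x < g x}"
    and U: "continuous_on UNIV U"
    and less: "\<And>x y. (x, y) \<in> fun_rel F \<Longrightarrow> q x < U y"
  obtains g where "g \<in> F" "\<And>x. q x < g x" "\<And>x. g x < U x"
proof -
  \<comment> \<open>Finite minima produce a member of the lattice below U that exceeds q at one given point.\<close>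
  have step: "\<exists>g\<in>F. (\<forall>y. g y < U y) \<and> q x < g x" for x
  proof -
    have "compact {y. (x, y) \<in> fun_rel F}"
      using compact_Int_closed[OF comp closed_fun_rel_class[OF F, of x]] by simp
    then have "\<exists>y0\<in>{y. (x, y) \<in> fun_rel F}. \<forall>y\<in>{y. (x, y) \<in> fun_rel F}. U y0 \<le> U y"
      by (rule continuous_attains_inf)
        (auto intro: continuous_on_subset[OF U] exI[of _ x])
    then obtain y0 where y0: "(x, y0) \<in> fun_rel F" "\<And>y. (x, y) \<in> fun_rel F \<Longrightarrow> U y0 \<le> U y"
      by auto
    obtain c where c: "q x < c" "c < U y0"
      using dense[OF less[OF y0(1)]] by blast
    have "\<exists>g\<in>F. g x = c \<and> g y < U y" for y
    proof (cases "(x, y) \<in> fun_rel F")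
      case True
      then show ?thesis using y0(2) c lattice_const[OF F, of c] by (intro bexI[of _ "\<lambda>_. c"]) force+
    next
      case False
      then obtain g where "g \<in> F" "g x = c" "g y = U y - 1"
        by (rule lattice_interpolate[OF F])
      then show ?thesis by (intro bexI[of _ g]) auto
    qed
    then obtain G where G: "\<And>y. G y \<in> F" "\<And>y. G y x = c" "\<And>y. G y y < U y"
      by metis
    have "open {z. G y z < U z}" for y
      by (intro open_Collect_less lattice_continuous[OF F] G U)
    then have "\<exists>I. finite I \<and> I \<noteq> {} \<and> (\<forall>z. \<exists>y\<in>I. G y z < U z)"
      using G(3) by (rule compact_UNIV_finite_cover[OF comp])
    then obtain I where I: "finite I" "I \<noteq> {}" "\<And>z. \<exists>y\<in>I. G y z < U z"
      by auto
    have "(\<lambda>z. Min ((\<lambda>i. G i z) ` I)) \<in> F"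
      by (intro lattice_Min[OF F] I G)
    moreover have "Min ((\<lambda>i. G i z) ` I) < U z" for z
      using I by (subst Min_less_iff) auto
    moreover have "Min ((\<lambda>i. G i x) ` I) = c"
      using I G(2) by simp
    ultimately show ?thesis using c by (intro bexI[of _ "\<lambda>z. Min ((\<lambda>i. G i z) ` I)"]) auto
  qed
  \<comment> \<open>Finite maxima of these functions exceed q everywhere.\<close>
  then obtain H where H: "\<And>x. H x \<in> F" "\<And>x y. H x y < U y" "\<And>x. q x < H x x"
    by metis
  have "open {z. q z < H x z}" for x
    by (intro q lattice_continuous[OF F] H)
  then have "\<exists>I. finite I \<and> I \<noteq> {} \<and> (\<forall>z. \<exists>x\<in>I. q z < H x z)"
    using H(3) by (rule compact_UNIV_finite_cover[OF comp])
  then obtain I where I: "finite I" "I \<noteq> {}" "\<And>z. \<exists>x\<in>I. q z < H x z"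
    by auto
  show ?thesis
  proof (rule that)
    show "(\<lambda>z. Max ((\<lambda>i. H i z) ` I)) \<in> F"
      by (intro lattice_Max[OF F] I H)
    show "q z < Max ((\<lambda>i. H i z) ` I)" for z
      using I by (subst Max_gr_iff) auto
    show "Max ((\<lambda>i. H i z) ` I) < U z" for z
      using I H(2) by (subst Max_less_iff) auto
  qed
qed

section \<open>Alternating sequences and potentials\<close>

text \<open>
  The sequences whose first \<open>n\<close> steps alternate between the relations \<open>R\<close> and \<open>R'\<close>, beginning with
  \<open>R\<close>. Only the points \<open>x 0, \<dots>, x n\<close> matter. Consecutive points may coincide, which makes the set
  closed in the product topology and hence compact; bolts are the alternating sequences without such
  repetitions. Taking functions on all natural numbers makes Tychonoff's theorem directly applicable.
\<close>

definition alternating :: "('a \<times> 'a) set \<Rightarrow> ('a \<times> 'a) set \<Rightarrow> nat \<Rightarrow> (nat \<Rightarrow> 'a) set" where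
  "alternating R R' n = {x. \<forall>i<n. (x i, x (Suc i)) \<in> (if even i then R else R')}"

lemma alternatingD:
  "x \<in> alternating R R' n \<Longrightarrow> i < n \<Longrightarrow> (x i, x (Suc i)) \<in> (if even i then R else R')"
  by (auto simp: alternating_def)

lemma compact_UNIV_sequences:
  assumes "compact (UNIV :: 'a::topological_space set)"
  shows "compact (UNIV :: (nat \<Rightarrow> 'a) set)"
proof -
  have "compact_space (product_topology (\<lambda>_::nat. euclidean :: 'a topology) UNIV)"
    using assms by (simp only: compact_space_product_topology) (simp add: compact_space_def)
  then show ?thesis
    by (simp add: euclidean_product_topology compact_space_def)
qed

lemma compact_alternating:
  fixes F F' :: "('a::topological_space \<Rightarrow> real) set"
  assumes comp: "compact (UNIV :: 'a set)"
    and F: "continuous_lattice F" "continuous_lattice F'"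
  shows "compact (alternating (fun_rel F) (fun_rel F') n)"
proof -
  let ?F = "\<lambda>i::nat. if even i then F else F'"
  have "alternating (fun_rel F) (fun_rel F') n =
      (\<Inter>i\<in>{..<n}. \<Inter>g\<in>?F i. {x. g (x i) = g (x (Suc i))})"
    by (auto simp: alternating_def fun_rel_def split: if_splits; blast)
  moreover have "closed {x::nat \<Rightarrow> 'a. g (x i) = g (x (Suc i))}" if "g \<in> ?F i" for i g
  proof -
    have g: "continuous_on UNIV g"
      using that lattice_continuous[OF F(1)] lattice_continuous[OF F(2)] by (auto split: if_splits)
    show ?thesis
      by (intro closed_Collect_eq continuous_on_compose2[OF g]) auto
  qed
  ultimately have "closed (alternating (fun_rel F) (fun_rel F') n)"
    by (auto intro!: closed_INT)
  then show ?thesis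
    using compact_Int_closed[OF compact_UNIV_sequences[OF comp]] by simp
qed

lemma continuous_on_coordinate_compose:
  fixes g :: "'a::topological_space \<Rightarrow> 'b::topological_space"
  assumes "continuous_on UNIV g"
  shows "continuous_on A (\<lambda>z :: nat \<Rightarrow> 'a. g (z i))"
proof -
  have "continuous_on UNIV (\<lambda>z :: nat \<Rightarrow> 'a. g (z i))"
    by (rule continuous_on_compose2[OF assms continuous_on_product_coordinates]) auto
  then show ?thesis by (rule continuous_on_subset) auto
qed

text \<open>
  The duality behind the whole argument. Let \<open>f i\<close> be a cost for visiting a point as the \<open>i\<close>-th point
  of an alternating sequence. If all sequences of \<open>n + 1\<close> points have negative total cost, then the
  costs are strictly dominated by differences \<open>g i - g (i + 1)\<close> of continuous potentials with
  \<open>g 0 = g (n + 1) = 0\<close> which lie alternately in \<open>F\<close> and \<open>F'\<close>. The converse is immediate, because the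
  differences telescope along an alternating sequence.
  
  The induction chooses \<open>g 1\<close> first. It has to lie below \<open>- f 0\<close> and above the function \<open>q\<close> that
  assigns to \<open>y\<close> the largest cost of the remaining points of a sequence whose second point is \<open>y\<close>.
  This \<open>q\<close> is only upper semicontinuous, and the insertion theorem supplies \<open>g 1\<close>. Subtracting \<open>g 1\<close>
  from \<open>f 1\<close> leaves a problem with one point fewer and with the two lattices exchanged.
\<close>

lemma alternating_potentials:
  fixes F F' :: "('a::metric_space \<Rightarrow> real) set" and f :: "nat \<Rightarrow> 'a \<Rightarrow> real"
  assumes comp: "compact (UNIV :: 'a set)"
    and "continuous_lattice F" "continuous_lattice F'"
    and "\<And>i. continuous_on UNIV (f i)"
    and "\<And>x. x \<in> alternating (fun_rel F) (fun_rel F') n \<Longrightarrow> (\<Sum>i\<le>n. f i (x i)) < 0"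
  shows "\<exists>g. g 0 = (\<lambda>_. 0) \<and> g (Suc n) = (\<lambda>_. 0) \<and> (\<forall>i. g i \<in> (if odd i then F else F')) \<and>
    (\<forall>i\<le>n. \<forall>x. f i x < g i x - g (Suc i) x)"
  using assms(2-)
proof (induction n arbitrary: F F' f)
  case 0
  have "f 0 x < 0" for x
    using "0.prems"(4)[of "\<lambda>_. x"] by (simp add: alternating_def)
  then show ?case
    using "0.prems" by (intro exI[of _ "\<lambda>_ _. 0"]) (auto intro: lattice_const)
next
  case (Suc n)
  note F = Suc.prems(1) and F' = Suc.prems(2) and f = Suc.prems(3) and neg = Suc.prems(4)
  let ?B = "alternating (fun_rel F') (fun_rel F) n"
  let ?T = "\<lambda>z. \<Sum>i\<le>n. f (Suc i) (z i)"
  have compB: "compact ?B" by (rule compact_alternating[OF comp F' F])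
  have contT: "continuous_on UNIV ?T"
    by (intro continuous_on_sum continuous_on_coordinate_compose f)
  have "\<exists>w\<in>?B. w 0 = y \<and> (\<forall>z\<in>?B. z 0 = y \<longrightarrow> ?T z \<le> ?T w)" for y
  proof -
    have "closed {z :: nat \<Rightarrow> 'a. z 0 = y}"
      by (intro closed_Collect_eq) auto
    then have "compact (?B \<inter> {z. z 0 = y})"
      by (rule compact_Int_closed[OF compB])
    moreover have "(\<lambda>_. y) \<in> ?B \<inter> {z. z 0 = y}"
      by (simp add: alternating_def)
    ultimately have "\<exists>w\<in>?B \<inter> {z. z 0 = y}. \<forall>z\<in>?B \<inter> {z. z 0 = y}. ?T z \<le> ?T w"
      by (intro continuous_attains_sup continuous_on_subset[OF contT]) auto
    then show ?thesis by auto
  qed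
  then obtain w where w: "\<And>y. w y \<in> ?B" "\<And>y. w y 0 = y"
      "\<And>y z. z \<in> ?B \<Longrightarrow> z 0 = y \<Longrightarrow> ?T z \<le> ?T (w y)"
    by metis
  define q where "q y = ?T (w y)" for y
  have usc: "open {y. q y < g y}" if g: "continuous_on UNIV g" for g
  proof -
    \<comment> \<open>The complement is the projection of a compact set of sequences.\<close>
    have "closed {z :: nat \<Rightarrow> 'a. g (z 0) \<le> ?T z}"
      by (intro closed_Collect_le contT continuous_on_coordinate_compose g)
    then have "compact ((\<lambda>z. z 0) ` (?B \<inter> {z. g (z 0) \<le> ?T z}))"
      by (intro compact_continuous_image compact_Int_closed[OF compB] 
          continuous_on_subset[OF continuous_on_product_coordinates]) auto
    moreover have "(\<lambda>z. z 0) ` (?B \<inter> {z. g (z 0) \<le> ?T z}) = - {y. q y < g y}"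
    proof (intro set_eqI iffI)
      fix y assume "y \<in> - {y. q y < g y}"
      then have "w y \<in> ?B \<inter> {z. g (z 0) \<le> ?T z}"
        using w by (simp add: q_def not_less)
      then show "y \<in> (\<lambda>z. z 0) ` (?B \<inter> {z. g (z 0) \<le> ?T z})"
        by (rule rev_image_eqI) (simp add: w(2))
    next
      fix y assume "y \<in> (\<lambda>z. z 0) ` (?B \<inter> {z. g (z 0) \<le> ?T z})"
      then obtain z where "z \<in> ?B" "g (z 0) \<le> ?T z" "y = z 0" by auto
      then show "y \<in> - {y. q y < g y}"
        using w(3)[of z y] by (simp add: q_def not_less)
    qed
    ultimately show ?thesis
      using compact_imp_closed open_closed by metis
  qed
  have less: "q x < - f 0 y" if xy: "(x, y) \<in> fun_rel F" for x y
  proof -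
    have "case_nat y (w x) \<in> alternating (fun_rel F) (fun_rel F') (Suc n)"
      unfolding alternating_def
    proof (intro CollectI allI impI)
      fix i assume "i < Suc n"
      then show "(case_nat y (w x) i, case_nat y (w x) (Suc i)) \<in> (if even i then fun_rel F else fun_rel F')"
        using alternatingD[OF w(1)[of x], of "i - 1"] fun_rel_sym[OF xy] w(2)[of x]
        by (cases i) (simp_all split: if_splits)
    qed
    then show ?thesis
      using neg[of "case_nat y (w x)"] unfolding q_def sum.atMost_Suc_shift by simp
  qed
  obtain h where h: "h \<in> F" "\<And>x. q x < h x" "\<And>x. h x < - f 0 x"
    by (rule lattice_insertion[OF comp F usc _ less]) (auto intro!: continuous_intros f)
  define f' where "f' i x = (if i = 0 then f 1 x - h x else f (Suc i) x)" for i x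
  have "continuous_on UNIV (f' i)" for i
    using f lattice_continuous[OF F h(1)] by (cases "i = 0") (auto simp: f'_def intro!: continuous_intros)
  moreover have "(\<Sum>i\<le>n. f' i (x i)) < 0" if "x \<in> ?B" for x
  proof -
    have "(\<Sum>i\<le>n. f' i (x i)) = ?T x - h (x 0)"
      unfolding f'_def sum.atMost_shift by simp
    also have "\<dots> \<le> q (x 0) - h (x 0)"
      using w(3)[OF that] by (simp add: q_def)
    also have "\<dots> < 0" using h(2) by simp
    finally show ?thesis .
  qed
  ultimately obtain g where g: "g 0 = (\<lambda>_. 0)" "g (Suc n) = (\<lambda>_. 0)"
      "\<And>i. g i \<in> (if odd i then F' else F)" "\<And>i x. i \<le> n \<Longrightarrow> f' i x < g i x - g (Suc i) x"
    using Suc.IH[OF F' F, of f'] by blast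
  define G where "G i = (case i of 0 \<Rightarrow> \<lambda>_. 0 | Suc 0 \<Rightarrow> h | Suc (Suc j) \<Rightarrow> g (Suc j))" for i
  have "G i \<in> (if odd i then F else F')" for i
  proof -
    consider "i = 0" | "i = 1" | j where "i = Suc (Suc j)" by (metis One_nat_def nat.exhaust)
    then show ?thesis
      using h(1) g(3)[of "i - 1"] lattice_const[OF F', of 0] by cases (simp_all add: G_def split: if_splits)
  qed
  moreover have "f i x < G i x - G (Suc i) x" if "i \<le> Suc n" for i x
  proof -
    consider "i = 0" | "i = 1" | j where "i = Suc (Suc j)" by (metis One_nat_def nat.exhaust)
    then show ?thesis
      using that h(3)[of x] g(4)[of "i - 1" x] g(1) by cases (simp_all add: G_def f'_def)
  qed
  moreover have "G 0 = (\<lambda>_. 0)" "G (Suc (Suc n)) = (\<lambda>_. 0)"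
    by (auto simp: G_def g)
  ultimately show ?case by blast
qed

section \<open>Closed subalgebras\<close>

lemma apply_Bcontfun_of_compact:
  fixes g :: "'a::topological_space \<Rightarrow> real"
  assumes "compact (UNIV :: 'a set)" "continuous_on UNIV g"
  shows "apply_bcontfun (Bcontfun g) = g"
proof (rule Bcontfun_inverse)
  show "g \<in> bcontfun"
    using assms compact_imp_bounded[OF compact_continuous_image] by (auto simp: bcontfun_def)
qed

lemma subalgebra_polynomial:
  assumes "real_polynomial_function p" and A: "subalgebra_with_constants A" "f \<in> A"
  shows "\<exists>h\<in>A. \<forall>x. apply_bcontfun h x = p (apply_bcontfun f x)"
  using assms(1)
proof induction
  case (linear p)
  have p: "p t = p 1 * t" for t
  proof -
    have "p t = p (t *\<^sub>R 1)" by simp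
    also have "\<dots> = t *\<^sub>R p 1" by (rule linear_simps(5)[OF linear])
    finally show ?thesis by (simp only: real_scaleR_def mult.commute)
  qed
  have "apply_bcontfun (p 1 *\<^sub>R f) x = p (apply_bcontfun f x)" for x
    using p[of "apply_bcontfun f x"] by simp
  moreover have "p 1 *\<^sub>R f \<in> A"
    using A by (simp add: subalgebra_with_constants_def subspace_scale)
  ultimately show ?case by blast
next
  case (const c)
  then show ?case
    using A by (intro bexI[of _ "const_bcontfun c"])
      (auto simp: subalgebra_with_constants_def const_bcontfun.rep_eq)
next
  case (add p q)
  then obtain h k where "h \<in> A" "k \<in> A" "\<forall>x. apply_bcontfun h x = p (apply_bcontfun f x)"
      "\<forall>x. apply_bcontfun k x = q (apply_bcontfun f x)" by auto
  then show ?case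
    using A by (intro bexI[of _ "h + k"]) (auto simp: subalgebra_with_constants_def subspace_add)
next
  case (mult p q)
  then obtain h k where "h \<in> A" "k \<in> A" "\<forall>x. apply_bcontfun h x = p (apply_bcontfun f x)"
      "\<forall>x. apply_bcontfun k x = q (apply_bcontfun f x)" by auto
  then show ?case
    using A(1) unfolding subalgebra_with_constants_def by metis
qed

text \<open>
  A closed subalgebra is stable under composition with continuous functions of one real variable, by
  polynomial approximation on an interval that contains the range.
\<close>

lemma subalgebra_compose:
  fixes A :: "('a::topological_space \<Rightarrow>\<^sub>C real) set"
  assumes comp: "compact (UNIV :: 'a set)" and A: "subalgebra_with_constants A" "closed A"
    and f: "f \<in> A" and \<psi>: "continuous_on UNIV \<psi>"
  shows "\<exists>h\<in>A. \<forall>x. apply_bcontfun h x = \<psi> (apply_bcontfun f x)"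
proof -
  define h where "h = Bcontfun (\<lambda>x. \<psi> (apply_bcontfun f x))"
  have h: "apply_bcontfun h x = \<psi> (apply_bcontfun f x)" for x
    unfolding h_def
    by (subst apply_Bcontfun_of_compact[OF comp]) (auto intro: continuous_on_compose2[OF \<psi>])
  have "\<exists>k\<in>A. dist k h < e" if e: "e > 0" for e
  proof -
    obtain p where p: "real_polynomial_function p"
        "\<And>t. t \<in> {- norm f..norm f} \<Longrightarrow> \<bar>\<psi> t - p t\<bar> < e / 2"
    proof (rule Stone_Weierstrass_real_polynomial_function)
      show "continuous_on {- norm f..norm f} \<psi>" using continuous_on_subset[OF \<psi>] by simp
      show "0 < e / 2" using e by simp
    qed auto
    obtain k where k: "k \<in> A" "\<forall>x. apply_bcontfun k x = p (apply_bcontfun f x)"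
      using subalgebra_polynomial[OF p(1) A(1) f] by auto
    have "norm (apply_bcontfun (k - h) x) \<le> e / 2" for x
    proof -
      have "apply_bcontfun f x \<in> {- norm f..norm f}"
        using norm_bounded[of f x] by auto
      from p(2)[OF this] show ?thesis
        using k h by (simp add: abs_minus_commute)
    qed
    then have "dist k h \<le> e / 2"
      unfolding dist_norm by (rule norm_bound)
    then show ?thesis using k(1) that by (intro bexI[of _ k]) auto
  qed
  then have "h \<in> closure A" by (simp add: closure_approachable)
  then show ?thesis using A(2) h by (auto simp: closure_closed)
qed

lemma subalgebra_continuous_lattice:
  fixes A :: "('a::topological_space \<Rightarrow>\<^sub>C real) set"
  assumes comp: "compact (UNIV :: 'a set)" and A: "subalgebra_with_constants A" "closed A"
  shows "continuous_lattice (apply_bcontfun ` A)"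
proof -
  have sub: "subspace A" using A by (simp add: subalgebra_with_constants_def)
  have add: "(\<lambda>x. apply_bcontfun f x + apply_bcontfun g x) \<in> apply_bcontfun ` A"
    if "f \<in> A" "g \<in> A" for f g
    by (rule image_eqI[of _ _ "f + g"]) (auto simp: subspace_add[OF sub that])
  have scale: "(\<lambda>x. c * apply_bcontfun f x) \<in> apply_bcontfun ` A" if "f \<in> A" for f c
    by (rule image_eqI[of _ _ "c *\<^sub>R f"]) (auto simp: subspace_scale[OF sub that])
  have const: "(\<lambda>_. c) \<in> apply_bcontfun ` A" for c
    by (rule image_eqI[of _ _ "const_bcontfun c"])
      (use A in \<open>auto simp: const_bcontfun.rep_eq subalgebra_with_constants_def\<close>)
  have max: "(\<lambda>x. max (apply_bcontfun f x) (apply_bcontfun g x)) \<in> apply_bcontfun ` A"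
    if "f \<in> A" "g \<in> A" for f g
  proof -
    have "f - g \<in> A" using subspace_diff[OF sub that] .
    then obtain h where h: "h \<in> A" "\<forall>x. apply_bcontfun h x = \<bar>apply_bcontfun (f - g) x\<bar>"
      using subalgebra_compose[OF comp A _ continuous_on_rabs[OF continuous_on_id]] by blast
    show ?thesis
    proof (rule image_eqI)
      show "(1 / 2) *\<^sub>R (f + g + h) \<in> A"
        using that h by (intro subspace_scale[OF sub] subspace_add[OF sub])
      show "(\<lambda>x. max (apply_bcontfun f x) (apply_bcontfun g x)) = apply_bcontfun ((1 / 2) *\<^sub>R (f + g + h))"
        using h(2) by (auto simp: max_def abs_if)
    qed
  qed
  show ?thesis
    unfolding continuous_lattice_def using add scale const max by auto
qed

lemma alg_rel_eq_fun_rel: "alg_rel A = fun_rel (apply_bcontfun ` A)"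
  by (auto simp: alg_rel_def fun_rel_def)

lemma sum_atMost_pairs: "(\<Sum>i\<le>2 * k + 1. h i) = (\<Sum>j\<le>k. h (2 * j) + h (2 * j + 1))"
  for h :: "nat \<Rightarrow> 'b::comm_monoid_add"
  by (induction k) (simp_all add: add.assoc)

lemma approx_error_le_norm:
  assumes "u \<in> S"
  shows "approx_error S f \<le> norm (f - u)"
  unfolding approx_error_def by (rule cINF_lower[OF _ assms]) (auto intro: bdd_belowI[of _ 0])

section \<open>Approximation from averages over alternating sequences\<close>

text \<open>
  If the alternating averages of \<open>f\<close> over the sequences of \<open>2 * (k + 1)\<close> points with first step in
  \<open>alg_rel A1\<close> stay below \<open>\<sigma>\<close>, then \<open>f\<close> is within \<open>\<sigma>\<close> of the sum of the algebras. Potentials exist for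
  the costs \<open>\<plusminus> f - \<sigma>\<close>, and their differences \<open>g i - g (i + 1)\<close> sum to zero. So the even
  differences and the odd differences have opposite sums, and bounding each of the two sums from
  below by costs bounds \<open>f\<close> on both sides by the same element of the sum of the algebras.
\<close>

lemma approx_error_le_alternating_average:
  fixes A1 A2 :: "('a::metric_space \<Rightarrow>\<^sub>C real) set"
  assumes comp: "compact (UNIV :: 'a set)"
    and A1: "subalgebra_with_constants A1" "closed A1"
    and A2: "subalgebra_with_constants A2" "closed A2"
    and less: "\<And>x. x \<in> alternating (alg_rel A1) (alg_rel A2) (2 * k + 1) \<Longrightarrow>
      (\<Sum>i\<le>2 * k + 1. (- 1) ^ i * apply_bcontfun f (x i)) < 2 * real (k + 1) * \<sigma>"
  shows "approx_error (A1 + A2) f \<le> \<sigma>"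
proof -
  let ?F1 = "apply_bcontfun ` A1" and ?F2 = "apply_bcontfun ` A2"
  note F1 = subalgebra_continuous_lattice[OF comp A1]
  note F2 = subalgebra_continuous_lattice[OF comp A2]
  define c where "c i x = (- 1) ^ i * apply_bcontfun f x - \<sigma>" for i :: nat and x
  have "continuous_on UNIV (c i)" for i
    unfolding c_def by (intro continuous_intros) auto
  moreover have "(\<Sum>i\<le>2 * k + 1. c i (x i)) < 0"
    if "x \<in> alternating (fun_rel ?F1) (fun_rel ?F2) (2 * k + 1)" for x
    using less[of x] that unfolding c_def sum_subtractf by (simp add: alg_rel_eq_fun_rel algebra_simps)
  ultimately obtain g where g: "g 0 = (\<lambda>_. 0)" "g (Suc (2 * k + 1)) = (\<lambda>_. 0)"
      "\<And>i. g i \<in> (if odd i then ?F1 else ?F2)"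
      "\<And>i x. i \<le> 2 * k + 1 \<Longrightarrow> c i x < g i x - g (Suc i) x"
    using alternating_potentials[OF comp F1 F2, of c "2 * k + 1"] by blast
  have "(\<lambda>x. 1 / real (k + 1) * (\<Sum>j\<le>k. g (2 * j) x)) \<in> ?F2"
    using g(3)[of "2 * _"] by (intro lattice_scale[OF F2] lattice_sum[OF F2]) auto
  then obtain u2 where u2: "u2 \<in> A2"
      "apply_bcontfun u2 = (\<lambda>x. 1 / real (k + 1) * (\<Sum>j\<le>k. g (2 * j) x))" by auto
  have "(\<lambda>x. (- 1 / real (k + 1)) * (\<Sum>j\<le>k. g (2 * j + 1) x)) \<in> ?F1"
    using g(3)[of "2 * _ + 1"] by (intro lattice_scale[OF F1] lattice_sum[OF F1]) auto
  then obtain u1 where u1: "u1 \<in> A1"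
      "apply_bcontfun u1 = (\<lambda>x. (- 1 / real (k + 1)) * (\<Sum>j\<le>k. g (2 * j + 1) x))" by auto
  have "norm (apply_bcontfun (f - (u1 + u2)) x) \<le> \<sigma>" for x
  proof -
    let ?e = "\<Sum>j\<le>k. g (2 * j) x - g (2 * j + 1) x"
    let ?o = "\<Sum>j\<le>k. g (2 * j + 1) x - g (2 * j + 2) x"
    have u: "real (k + 1) * apply_bcontfun (u1 + u2) x = ?e"
      by (simp add: u1 u2 sum_subtractf field_simps del: of_nat_Suc)
    have "?e + ?o = (\<Sum>j\<le>k. g (2 * j) x - g (2 * Suc j) x)"
      by (simp add: sum.distrib[symmetric])
    also have "\<dots> = 0"
      using g(1,2) by (subst sum_telescope) simp
    finally have "?o = - ?e" by simp
    have "(\<Sum>j\<le>k. apply_bcontfun f x - \<sigma>) \<le> ?e"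
      using g(4)[of "2 * _" x] by (intro sum_mono) (auto simp: c_def intro: less_imp_le)
    then have 1: "real (k + 1) * (apply_bcontfun f x - \<sigma>) \<le> real (k + 1) * apply_bcontfun (u1 + u2) x"
      by (simp only: u) simp
    have "(\<Sum>j\<le>k. - apply_bcontfun f x - \<sigma>) \<le> ?o"
      using g(4)[of "2 * _ + 1" x] by (intro sum_mono) (auto simp: c_def intro: less_imp_le)
    then have 2: "real (k + 1) * (apply_bcontfun (u1 + u2) x) \<le> real (k + 1) * (apply_bcontfun f x + \<sigma>)"
      unfolding \<open>?o = - ?e\<close> by (simp only: u) (simp add: algebra_simps)
    have "apply_bcontfun f x - \<sigma> \<le> apply_bcontfun (u1 + u2) x"
      using 1 by (subst (asm) mult_le_cancel_left_pos) auto
    moreover have "apply_bcontfun (u1 + u2) x \<le> apply_bcontfun f x + \<sigma>"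
      using 2 by (subst (asm) mult_le_cancel_left_pos) auto
    ultimately show ?thesis by (simp add: abs_le_iff)
  qed
  then have "norm (f - (u1 + u2)) \<le> \<sigma>" by (rule norm_bound)
  moreover have "u1 + u2 \<in> A1 + A2" using u1 u2 by (intro set_plus_intro)
  ultimately show ?thesis using approx_error_le_norm[of "u1 + u2" "A1 + A2" f] by linarith
qed

section \<open>Bounded length of connections when the sum is closed\<close>

text \<open>
  The uniform boundedness principle for functionals on a closed subspace.
\<close>

lemma uniform_boundedness:
  fixes T :: "'i \<Rightarrow> 'b::{real_normed_vector, complete_space} \<Rightarrow> real"
  assumes S: "closed S" "subspace S"
    and T: "\<And>i. i \<in> I \<Longrightarrow> bounded_linear (T i)"
    and bounded: "\<And>u. u \<in> S \<Longrightarrow> \<exists>c. \<forall>i\<in>I. \<bar>T i u\<bar> \<le> c"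
  shows "\<exists>K. \<forall>i\<in>I. \<forall>u\<in>S. \<bar>T i u\<bar> \<le> K * norm u"
proof -
  let ?X = "top_of_set S"
  define C where "C N = {u \<in> S. \<forall>i\<in>I. \<bar>T i u\<bar> \<le> real N}" for N :: nat
  have closedC: "closedin ?X (C N)" for N
  proof -
    have "C N = S \<inter> (\<Inter>i\<in>I. {u. \<bar>T i u\<bar> \<le> real N})" by (auto simp: C_def)
    moreover have "closed {u. \<bar>T i u\<bar> \<le> real N}" if "i \<in> I" for i
      by (intro closed_Collect_le continuous_on_rabs linear_continuous_on T that continuous_on_const)
    then have "closed (\<Inter>i\<in>I. {u. \<bar>T i u\<bar> \<le> real N})" by (intro closed_INT ballI)
    ultimately show ?thesis unfolding closedin_closed by blast
  qed
  have union: "(\<Union>N. C N) = S"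
  proof (intro equalityI subsetI)
    fix u assume "u \<in> S"
    then obtain c where c: "\<And>i. i \<in> I \<Longrightarrow> \<bar>T i u\<bar> \<le> c" using bounded[of u] by blast
    obtain N :: nat where N: "c \<le> real N" using real_arch_simple by auto
    have "u \<in> C N" using order_trans[OF c N] \<open>u \<in> S\<close> by (simp add: C_def)
    then show "u \<in> (\<Union>N. C N)" by blast
  qed (auto simp: C_def)
  have "completely_metrizable_space ?X"
    using S(1) completely_metrizable_space_closedin[OF completely_metrizable_space_euclidean] by simp
  have "\<exists>N. ?X interior_of C N \<noteq> {}"
  proof (rule ccontr)
    assume "\<nexists>N. ?X interior_of C N \<noteq> {}"
    then have "?X interior_of \<Union> (range C) = {}"
      using \<open>completely_metrizable_space ?X\<close> closedC by (intro Baire_category_alt) auto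
    then have "S = {}"
      using union interior_of_topspace[of ?X] by simp
    then show False using subspace_0[OF S(2)] by simp
  qed
  then obtain N u0 where "u0 \<in> ?X interior_of C N" by auto
  then obtain V where V: "openin ?X V" "u0 \<in> V" "V \<subseteq> C N" by (auto simp: interior_of_def)
  then obtain e where e: "e > 0" "ball u0 e \<inter> S \<subseteq> V"
    unfolding openin_contains_ball by blast
  have u0: "u0 \<in> C N" using V by auto
  have "\<bar>T i v\<bar> \<le> (4 * real N / e) * norm v" if iv: "i \<in> I" "v \<in> S" for i v
  proof (cases "v = 0")
    case True
    then show ?thesis using T[OF iv(1)] by (simp add: linear_simps)
  next
    case False
    define t where "t = e / (2 * norm v)"
    have t: "t > 0" "t * norm v = e / 2" using False e by (auto simp: t_def)
    have "u0 + t *\<^sub>R v \<in> S"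
      using u0 iv(2) by (intro subspace_add[OF S(2)] subspace_scale[OF S(2)]) (auto simp: C_def)
    moreover have "dist u0 (u0 + t *\<^sub>R v) < e" using t e by (simp add: dist_norm)
    ultimately have "u0 + t *\<^sub>R v \<in> C N" using e V by auto
    then have "\<bar>T i (u0 + t *\<^sub>R v)\<bar> \<le> real N" "\<bar>T i u0\<bar> \<le> real N"
      using u0 iv(1) by (auto simp: C_def)
    moreover have "T i (u0 + t *\<^sub>R v) = T i u0 + t * T i v"
      using linear_simps[OF T[OF iv(1)]] by simp
    ultimately have "\<bar>t * T i v\<bar> \<le> 2 * real N" by linarith
    then have "\<bar>T i v\<bar> \<le> 2 * real N / t" using t by (simp add: abs_mult field_simps)
    also have "\<dots> = (4 * real N / e) * norm v" using False e by (simp add: t_def)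
    finally show ?thesis .
  qed
  then show ?thesis by blast
qed

lemma bounded_linear_evaluation: "bounded_linear (\<lambda>u. apply_bcontfun u x)"
  for x :: "'a::topological_space"
  by (rule bounded_linear_intro[of _ 1]) (use norm_bounded in auto)

text \<open>
  In the alternating sum of a function over an even number of points, the terms cancel in pairs if the
  function is constant on the classes of the first relation. If it is constant on the classes of the
  second one, then only the two end terms survive.
\<close>

lemma alternating_sum_even_class:
  assumes "x \<in> alternating (fun_rel F) R' (2 * k + 1)" "\<phi> \<in> F"
  shows "(\<Sum>i\<le>2 * k + 1. (- 1) ^ i * \<phi> (x i)) = (0 :: real)"
proof -
  have "\<phi> (x (2 * j)) = \<phi> (x (Suc (2 * j)))" if "j \<le> k" for j
    using alternatingD[OF assms(1), of "2 * j"] that assms(2) by (intro fun_rel_eq) auto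
  then show ?thesis
    unfolding sum_atMost_pairs by (intro sum.neutral) auto
qed

lemma alternating_sum_odd_class:
  assumes "x \<in> alternating R (fun_rel F') (2 * k + 1)" "\<phi> \<in> F'"
  shows "(\<Sum>i\<le>2 * k + 1. (- 1) ^ i * \<phi> (x i)) = (\<phi> (x 0) - \<phi> (x (2 * k + 1)) :: real)"
  using assms(1)
proof (induction k)
  case 0
  then show ?case by simp
next
  case (Suc k)
  have "x \<in> alternating R (fun_rel F') (2 * k + 1)"
    using Suc.prems by (auto simp: alternating_def)
  moreover have "\<phi> (x (2 * k + 1)) = \<phi> (x (Suc (2 * k + 1)))"
    using alternatingD[OF Suc.prems, of "2 * k + 1"] assms(2) by (intro fun_rel_eq) auto
  ultimately show ?case
    using Suc.IH by simp
qed

text \<open>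
  For an element \<open>u1 + u2\<close> of the sum, the alternating sum over a sequence is the difference of \<open>u2\<close> at
  the two ends, so it is bounded independently of the sequence. Closedness of the sum makes it a Banach
  space, and the bound becomes uniform in the norm of \<open>u1 + u2\<close>.
\<close>

lemma closed_sum_imp_end_difference_bound:
  fixes A1 A2 :: "('a::metric_space \<Rightarrow>\<^sub>C real) set"
  assumes "closed (A1 + A2)" "subspace (A1 + A2)"
  shows "\<exists>K. \<forall>k. \<forall>x\<in>alternating (alg_rel A1) (alg_rel A2) (2 * k + 1). \<forall>u1\<in>A1. \<forall>u2\<in>A2.
    \<bar>apply_bcontfun u2 (x 0) - apply_bcontfun u2 (x (2 * k + 1))\<bar> \<le> K * norm (u1 + u2)"
proof -
  define I where "I = (SIGMA k:UNIV. alternating (alg_rel A1) (alg_rel A2) (2 * k + 1))"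
  define T where "T = (\<lambda>(k, x) u. \<Sum>i\<le>2 * k + 1. (- 1) ^ i * apply_bcontfun u (x i :: 'a) :: real)"
  have T: "T (k, x) (u1 + u2) = apply_bcontfun u2 (x 0) - apply_bcontfun u2 (x (2 * k + 1))"
    if "x \<in> alternating (alg_rel A1) (alg_rel A2) (2 * k + 1)" "u1 \<in> A1" "u2 \<in> A2" for k x u1 u2
  proof -
    have "T (k, x) (u1 + u2) = (\<Sum>i\<le>2 * k + 1. (- 1) ^ i * apply_bcontfun u1 (x i)) +
        (\<Sum>i\<le>2 * k + 1. (- 1) ^ i * apply_bcontfun u2 (x i))"
      unfolding T_def sum.distrib[symmetric] by (simp add: distrib_left)
    then show ?thesis
      using that alternating_sum_even_class[of x "apply_bcontfun ` A1" _ k "apply_bcontfun u1"]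
        alternating_sum_odd_class[of x _ "apply_bcontfun ` A2" k "apply_bcontfun u2"]
      by (simp only: alg_rel_eq_fun_rel) auto
  qed
  have "\<exists>K. \<forall>i\<in>I. \<forall>u\<in>A1 + A2. \<bar>T i u\<bar> \<le> K * norm u"
  proof (rule uniform_boundedness[OF assms])
    show "bounded_linear (T i)" for i
      unfolding T_def split_def
      by (intro bounded_linear_sum bounded_linear_const_mult bounded_linear_evaluation)
    fix u assume "u \<in> A1 + A2"
    then obtain u1 u2 where u: "u = u1 + u2" "u1 \<in> A1" "u2 \<in> A2" by (rule set_plus_elim)
    have "\<bar>T i u\<bar> \<le> 2 * norm u2" if "i \<in> I" for i
    proof -
      obtain k x where i: "i = (k, x)" by (cases i)
      have "\<bar>T i u\<bar> = \<bar>apply_bcontfun u2 (x 0) - apply_bcontfun u2 (x (2 * k + 1))\<bar>"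
        using that u by (simp add: i T I_def)
      also have "\<dots> \<le> 2 * norm u2"
        using norm_bounded[of u2 "x 0"] norm_bounded[of u2 "x (2 * k + 1)"] by simp
      finally show ?thesis .
    qed
    then show "\<exists>c. \<forall>i\<in>I. \<bar>T i u\<bar> \<le> c" by blast
  qed
  then obtain K where K: "\<And>i u. i \<in> I \<Longrightarrow> u \<in> A1 + A2 \<Longrightarrow> \<bar>T i u\<bar> \<le> K * norm u" by blast
  show ?thesis
  proof (intro exI[of _ K] allI ballI)
    fix k x u1 u2
    assume *: "x \<in> alternating (alg_rel A1) (alg_rel A2) (2 * k + 1)" "u1 \<in> A1" "u2 \<in> A2"
    have "(k, x) \<in> I" using *(1) by (simp add: I_def)
    from K[OF this set_plus_intro[OF *(2,3)]]
    show "\<bar>apply_bcontfun u2 (x 0) - apply_bcontfun u2 (x (2 * k + 1))\<bar> \<le> K * norm (u1 + u2)"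
      by (simp only: T[OF *])
  qed
qed

text \<open>
  The consequence of such a uniform bound: if the points \<open>y\<close> and \<open>z\<close> satisfy it and \<open>k\<close> is large, then
  they are joined by an alternating sequence of \<open>2 * k + 1\<close> steps beginning with the second relation.
  When \<open>y\<close> and \<open>z\<close> are already joined by a sequence of \<open>2 * k + 1\<close> steps beginning with the first
  relation, the first and the last step of the new one merge with steps outside the old one, which is how
  connections get shorter.
  
  Otherwise, by compactness, all such sequences that start near \<open>y\<close> end at a definite distance from \<open>z\<close>.
  Penalising the distances from \<open>y\<close> and \<open>z\<close> yields potentials that are at most \<open>-1\<close> at \<open>y\<close> in the
  beginning, at least \<open>0\<close> at \<open>z\<close> in the end, and increase by at most \<open>\<delta>\<close> from one to the next. Truncated
  to the interval from \<open>-1\<close> to \<open>0\<close> and summed with alternating signs, they give \<open>\<phi>' - \<phi>\<close> of norm at most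
  2, although \<open>\<phi>'\<close> differs by at least \<open>(k + 1) / 2\<close> at \<open>y\<close> and \<open>z\<close>.
\<close>

lemma alternating_exchange:
  fixes F F' :: "('a::metric_space \<Rightarrow> real) set"
  assumes comp: "compact (UNIV :: 'a set)" and F: "continuous_lattice F" "continuous_lattice F'"
    and bound: "\<And>\<phi> \<phi>' B. \<phi> \<in> F \<Longrightarrow> \<phi>' \<in> F' \<Longrightarrow> (\<And>x. \<bar>\<phi>' x - \<phi> x\<bar> \<le> B) \<Longrightarrow> \<bar>\<phi>' y - \<phi>' z\<bar> \<le> K * B"
    and large: "4 * K < real (k + 1)"
  shows "\<exists>x\<in>alternating (fun_rel F') (fun_rel F) (2 * k + 1). x 0 = y \<and> x (2 * k + 1) = z"
proof (rule ccontr)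
  assume no_path: "\<not> ?thesis"
  let ?n = "2 * k + 1"
  let ?B = "alternating (fun_rel F') (fun_rel F) ?n"
  define D where "D x = dist (x 0) y + dist (x ?n) z" for x :: "nat \<Rightarrow> 'a"
  have "(\<lambda>_. y) \<in> ?B" by (simp add: alternating_def)
  have contD: "continuous_on ?B D"
    unfolding D_def
    by (intro continuous_on_add continuous_on_coordinate_compose[where g = "\<lambda>p. dist p _"] continuous_intros)
  have "\<exists>w\<in>?B. \<forall>x\<in>?B. D w \<le> D x"
    using \<open>(\<lambda>_. y) \<in> ?B\<close> by (intro continuous_attains_inf compact_alternating comp F contD) auto
  then obtain w where w: "w \<in> ?B" "\<And>x. x \<in> ?B \<Longrightarrow> D w \<le> D x" by blast
  have "D w \<noteq> 0"
    using no_path w(1) add_nonneg_eq_0_iff[of "dist (w 0) y" "dist (w ?n) z"] by (auto simp: D_def)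
  then have Dw: "D w > 0" by (simp add: D_def less_le)
  \<comment> \<open>The penalty C makes the two ends together cost at most 1 - 2 < 0.\<close>
  define C where "C = 2 / D w"
  define \<delta> where "\<delta> = 1 / (8 * real (k + 1))"
  have \<delta>: "\<delta> > 0" "real k * \<delta> \<le> 1 / 8" by (auto simp: \<delta>_def field_simps)
  define f where "f i x = (if i = 0 then 1 - C * dist x y else if i = ?n then - C * dist x z else - \<delta>)"
    for i :: nat and x
  have "continuous_on UNIV (f i)" for i
    by (cases "i = 0"; cases "i = ?n") (auto simp: f_def intro!: continuous_intros)
  moreover have "(\<Sum>i\<le>?n. f i (x i)) < 0" if "x \<in> ?B" for x
  proof -
    have "(\<Sum>i\<le>?n. f i (x i)) = f 0 (x 0) + (\<Sum>i<2 * k. f (Suc i) (x (Suc i))) + f ?n (x ?n)"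
      using sum.atMost_shift[of "\<lambda>i. f i (x i)" "2 * k"] by simp
    also have "(\<Sum>i<2 * k. f (Suc i) (x (Suc i))) \<le> 0"
      using \<delta> by (intro sum_nonpos) (auto simp: f_def)
    also have "f 0 (x 0) + 0 + f ?n (x ?n) = 1 - C * D x"
      by (simp add: f_def D_def algebra_simps)
    also have "\<dots> \<le> 1 - C * D w"
      using w(2)[OF that] Dw by (simp add: C_def field_simps)
    also have "\<dots> < 0" using Dw by (simp add: C_def)
    finally show ?thesis by simp
  qed
  ultimately obtain g where g: "g 0 = (\<lambda>_. 0)" "g (Suc ?n) = (\<lambda>_. 0)"
      "\<And>i. g i \<in> (if odd i then F' else F)" "\<And>i x. i \<le> ?n \<Longrightarrow> f i x < g i x - g (Suc i) x"
    using alternating_potentials[OF comp F(2) F(1), of f ?n] by blast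
  \<comment> \<open>The potentials need not be bounded; truncation preserves their almost monotonicity.\<close>
  define h where "h i x = max (- 1) (min 0 (g i x))" for i x
  have hF: "h i \<in> (if odd i then F' else F)" for i
    using g(3)[of i] F unfolding h_def
    by (auto intro!: lattice_max lattice_min lattice_const split: if_splits)
  have h_bounds: "- 1 \<le> h i x" "h i x \<le> 0" for i x by (auto simp: h_def)
  have h_step: "h (Suc i) x \<le> h i x + \<delta>" if "1 \<le> i" "i \<le> 2 * k" for i x
    using g(4)[of i x] that \<delta> by (auto simp: f_def h_def)
  have h_steps: "h (i + j) x \<le> h i x + real j * \<delta>" if "1 \<le> i" "i + j \<le> ?n" for i j x
    using that
  proof (induction j)
    case (Suc j)
    then show ?case using h_step[of "i + j" x] by (simp add: algebra_simps)
  qed simp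
  have hy: "h 1 y = - 1"
    using g(4)[of 0 y] g(1) by (simp add: f_def h_def)
  have hz: "h ?n z = 0"
    using g(4)[of ?n z] g(2) by (simp add: f_def h_def)
  define \<phi> where "\<phi> x = (\<Sum>j<k. h (2 * j + 2) x)" for x
  define \<phi>' where "\<phi>' x = (\<Sum>j\<le>k. h (2 * j + 1) x)" for x
  have "\<phi> \<in> F"
    unfolding \<phi>_def using hF[of "2 * _ + 2"] by (intro lattice_sum[OF F(1)]) auto
  moreover have "\<phi>' \<in> F'"
    unfolding \<phi>'_def using hF[of "2 * _ + 1"] by (intro lattice_sum[OF F(2)]) auto
  moreover have "\<bar>\<phi>' x - \<phi> x\<bar> \<le> 2" for x
  proof -
    have "\<phi>' x - \<phi> x = h 1 x + (\<Sum>j<k. h (2 * j + 3) x - h (2 * j + 2) x)"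
      unfolding \<phi>_def \<phi>'_def sum.atMost_shift sum_subtractf by (simp add: numeral_3_eq_3)
    also have "\<dots> \<le> 0 + (\<Sum>j<k. \<delta>)"
      using h_step[of "2 * _ + 2" x] h_bounds(2)[of 1 x]
      by (intro add_mono sum_mono) (auto simp: numeral_3_eq_3 algebra_simps)
    finally have "\<phi>' x - \<phi> x \<le> real k * \<delta>" by simp
    have "\<phi>' x - \<phi> x = (\<Sum>j<k. h (2 * j + 1) x - h (2 * j + 2) x) + h ?n x"
      unfolding \<phi>_def \<phi>'_def sum_subtractf by (simp add: lessThan_Suc_atMost[symmetric])
    also have "\<dots> \<ge> (\<Sum>j<k. - \<delta>) + (- 1)"
      using h_step[of "2 * _ + 1" x] h_bounds(1)[of ?n x]
      by (intro add_mono sum_mono) (auto simp: algebra_simps)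
    finally have "\<phi>' x - \<phi> x \<ge> - (real k * \<delta>) - 1" by simp
    with \<open>\<phi>' x - \<phi> x \<le> real k * \<delta>\<close> show ?thesis using \<delta>(2) by linarith
  qed
  ultimately have "\<bar>\<phi>' y - \<phi>' z\<bar> \<le> K * 2" by (rule bound)
  moreover have "\<phi>' y \<le> (\<Sum>j\<le>k. - 3 / 4)"
    unfolding \<phi>'_def
  proof (intro sum_mono)
    fix j assume "j \<in> {..k}"
    then have "h (2 * j + 1) y \<le> - 1 + real (2 * j) * \<delta>"
      using h_steps[of 1 "2 * j" y] hy by (simp add: add.commute)
    moreover have "real (2 * j) * \<delta> \<le> 2 * (real k * \<delta>)"
      using \<open>j \<in> {..k}\<close> \<delta> by simp
    ultimately show "h (2 * j + 1) y \<le> - 3 / 4" using \<delta>(2) by linarith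
  qed
  moreover have "\<phi>' z \<ge> (\<Sum>j\<le>k. - 1 / 4)"
    unfolding \<phi>'_def
  proof (intro sum_mono)
    fix j assume "j \<in> {..k}"
    then have "2 * j + 1 + 2 * (k - j) = ?n" by simp
    then have "h ?n z \<le> h (2 * j + 1) z + real (2 * (k - j)) * \<delta>"
      using h_steps[of "2 * j + 1" "2 * (k - j)" z] by simp
    moreover have "real (2 * (k - j)) * \<delta> \<le> 2 * (real k * \<delta>)"
      using \<delta> by simp
    ultimately show "- 1 / 4 \<le> h (2 * j + 1) z" using \<delta>(2) hz by linarith
  qed
  ultimately show False using large by simp argo
qed

text \<open>
  If long sequences beginning with \<open>R\<close> can be exchanged for sequences of the same length beginning with
  \<open>R'\<close>, then long sequences beginning with \<open>R'\<close> can be shortened to a fixed length. The points strictly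
  inside such a sequence form a sequence beginning with \<open>R\<close>; after the exchange, both its end steps
  belong to \<open>R'\<close> and merge with the two outer steps.
\<close>

lemma alternating_shorten:
  assumes exchange: "\<And>k x. k0 \<le> k \<Longrightarrow> x \<in> alternating R R' (2 * k + 1) \<Longrightarrow>
      \<exists>z\<in>alternating R' R (2 * k + 1). z 0 = x 0 \<and> z (2 * k + 1) = x (2 * k + 1)"
    and R': "refl R'" "trans R'"
    and "k0 \<le> k" "x \<in> alternating R' R (2 * k + 1)"
  shows "\<exists>z\<in>alternating R' R (2 * k0 + 1). z 0 = x 0 \<and> z (2 * k0 + 1) = x (2 * k + 1)"
  using assms(4,5)
proof (induction k arbitrary: x rule: nat_induct_at_least)
  case base
  then show ?case by blast
next
  case (Suc k)
  have x: "(x i, x (Suc i)) \<in> (if even i then R' else R)" if "i < 2 * k + 3" for i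
    using alternatingD[OF Suc.prems, of i] that by simp
  have "(\<lambda>i. x (Suc i)) \<in> alternating R R' (2 * k + 1)"
    unfolding alternating_def
  proof (intro CollectI allI impI)
    fix i assume "i < 2 * k + 1"
    then show "(x (Suc i), x (Suc (Suc i))) \<in> (if even i then R else R')"
      using x[of "Suc i"] by (auto split: if_splits)
  qed
  then obtain z where z: "z \<in> alternating R' R (2 * k + 1)" "z 0 = x 1" "z (2 * k + 1) = x (2 * k + 2)"
    using exchange[OF Suc.hyps] by fastforce
  define y where "y i = (if i = 0 then x 0 else if i = 2 * k + 1 then x (2 * k + 3) else z i)" for i
  have "y \<in> alternating R' R (2 * k + 1)"
    unfolding alternating_def
  proof (intro CollectI allI impI)
    fix i assume i: "i < 2 * k + 1"
    note zi = alternatingD[OF z(1) i]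
    show "(y i, y (Suc i)) \<in> (if even i then R' else R)"
    proof (cases "even i")
      case True
      have "(y i, z i) \<in> R'"
        using True i x[of 0] z(2) reflD[OF R'(1)] by (auto simp: y_def)
      moreover have "(z i, z (Suc i)) \<in> R'" using zi True by simp
      moreover have "(z (Suc i), y (Suc i)) \<in> R'"
        using True i x[of "2 * k + 2"] z(3) reflD[OF R'(1)] by (auto simp: y_def numeral_3_eq_3)
      ultimately show ?thesis using True by (simp add: transD[OF R'(2)])
    next
      case False
      then have "i \<noteq> 0" "Suc i \<noteq> 2 * k + 1" by presburger+
      then show ?thesis using zi i by (simp add: y_def)
    qed
  qed
  then obtain v where "v \<in> alternating R' R (2 * k0 + 1)" "v 0 = y 0" "v (2 * k0 + 1) = y (2 * k + 1)"
    using Suc.IH by blast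
  then show ?case by (intro bexI[of _ v]) (auto simp: y_def numeral_3_eq_3)
qed

section \<open>Closed alternating sequences and closed bolts\<close>

text \<open>
  Cyclic alternating sequences \<open>x 0, \<dots>, x (n - 1)\<close> of even length, in which consecutive points may
  coincide.
\<close>

definition closed_alternating :: "('a \<times> 'a) set \<Rightarrow> ('a \<times> 'a) set \<Rightarrow> nat \<Rightarrow> (nat \<Rightarrow> 'a) \<Rightarrow> bool" where
  "closed_alternating R R' n x \<longleftrightarrow>
     even n \<and> (\<forall>i<n. (x i, x (Suc i mod n)) \<in> (if even i then R else R'))"

lemma closed_alternating_rotate:
  assumes "closed_alternating R R' n x"
  shows "closed_alternating R' R n (\<lambda>i. x (Suc i mod n))"
  unfolding closed_alternating_def
proof (intro conjI allI impI)
  show "even n" using assms by (simp add: closed_alternating_def)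
  fix i assume i: "i < n"
  then have "even (Suc i mod n) \<longleftrightarrow> odd i" using \<open>even n\<close> by (simp add: dvd_mod_iff)
  moreover have "Suc i mod n < n" using i by simp
  ultimately show "(x (Suc i mod n), x (Suc (Suc i mod n) mod n)) \<in> (if even i then R' else R)"
    using assms unfolding closed_alternating_def by (metis (full_types))
qed

lemma alternating_sum_rotate:
  fixes h :: "'a \<Rightarrow> real"
  assumes "even n"
  shows "(\<Sum>i<n. (- 1) ^ i * h (x (Suc i mod n))) = - (\<Sum>i<n. (- 1) ^ i * h (x i))"
proof (cases n)
  case (Suc m)
  have "(\<Sum>i<n. (- 1) ^ i * h (x (Suc i mod n))) = (\<Sum>i<m. (- 1) ^ i * h (x (Suc i))) - h (x 0)"
    using assms by (simp add: Suc)
  moreover have "(\<Sum>i<n. (- 1) ^ i * h (x i)) = h (x 0) - (\<Sum>i<m. (- 1) ^ i * h (x (Suc i)))"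
    unfolding Suc sum.lessThan_Suc_shift by (simp add: sum_negf)
  ultimately show ?thesis by simp
qed simp

text \<open>
  A bound for the closed alternating sequences without consecutive repetitions extends to all of them.
  Two consecutive equal points contribute opposite terms; after a rotation that brings them to the end
  they can be dropped, since their neighbours are related by transitivity.
\<close>

lemma closed_alternating_sum_bound:
  fixes h :: "'a \<Rightarrow> real"
  assumes trans: "trans R" "trans R'"
    and bound: "\<And>n x. n > 0 \<Longrightarrow> closed_alternating R R' n x \<or> closed_alternating R' R n x \<Longrightarrow>
      (\<And>i. i < n \<Longrightarrow> x i \<noteq> x (Suc i mod n)) \<Longrightarrow> \<bar>\<Sum>i<n. (- 1) ^ i * h (x i)\<bar> \<le> \<sigma> * real n"
    and \<sigma>: "\<sigma> \<ge> 0"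
    and "closed_alternating R R' n x \<or> closed_alternating R' R n x"
  shows "\<bar>\<Sum>i<n. (- 1) ^ i * h (x i)\<bar> \<le> \<sigma> * real n"
  using assms(5)
proof (induction n arbitrary: x rule: less_induct)
  case (less n)
  show ?case
  proof (cases "n > 0 \<and> (\<exists>i<n. x i = x (Suc i mod n))")
    case False
    then show ?thesis using bound[OF _ less.prems] by (cases "n = 0") auto
  next
    case True
    let ?rot = "\<lambda>y i. y (Suc i mod n)"
    define P where "P y \<longleftrightarrow> (closed_alternating R R' n y \<or> closed_alternating R' R n y) \<and>
      \<bar>\<Sum>i<n. (- 1) ^ i * h (y i)\<bar> = \<bar>\<Sum>i<n. (- 1) ^ i * h (x i)\<bar>" for y
    define Q where "Q y j \<longleftrightarrow> y j = y (Suc j mod n)" for y :: "nat \<Rightarrow> 'a" and j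
    have "even n" using less.prems by (auto simp: closed_alternating_def)
    then obtain m where n: "n = m + 2" "even m"
      using True by (metis add_2_eq_Suc' even_Suc gr0_implies_Suc odd_Suc_minus_one odd_pos even_zero Suc_pred)
    have rot: "P (?rot y)" if "P y" for y
      using that closed_alternating_rotate[of R R' n y] closed_alternating_rotate[of R' R n y]
      unfolding P_def alternating_sum_rotate[OF \<open>even n\<close>] by auto
    \<comment> \<open>A rotation moves the repetition one place to the left; two more rotations carry it
       from the positions 0, 1 around to the last two positions.\<close>
    have Q0: "\<exists>y. P y \<and> Q y 0" if "P y" "Q y j" "j < n" for y j
      using that
    proof (induction j arbitrary: y)
      case (Suc j)
      then have "Q (?rot y) j" by (simp add: Q_def)
      then show ?case using Suc rot by (meson Suc_lessD)
    qed blast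
    obtain i where "i < n" "x i = x (Suc i mod n)" using True by auto
    then obtain y0 where "P y0" "Q y0 0"
      using Q0[of x i] less.prems by (auto simp: P_def Q_def)
    then have "P (?rot (?rot y0))" "Q (?rot (?rot y0)) m"
      using rot by (auto simp: Q_def n)
    then obtain y where y: "P y" "y m = y (Suc m)" by (auto simp: Q_def n)
    have shorter: "closed_alternating S S' m y"
      if "closed_alternating S S' n y" "trans S'" for S S'
      unfolding closed_alternating_def
    proof (intro conjI allI impI)
      have S: "(y i, y (Suc i mod n)) \<in> (if even i then S else S')" if "i < n" for i
        using \<open>closed_alternating S S' n y\<close> that by (simp add: closed_alternating_def)
      fix i assume i: "i < m"
      show "(y i, y (Suc i mod m)) \<in> (if even i then S else S')"
      proof (cases "Suc i = m")
        case True
        then have "odd i" using n by auto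
        have "(y i, y m) \<in> S'" using S[of i] i n \<open>odd i\<close> True by auto
        moreover have "(y m, y 0) \<in> S'" using S[of "Suc m"] n y(2) by simp
        ultimately show ?thesis using True \<open>odd i\<close> transD[OF \<open>trans S'\<close>] by auto
      next
        case False
        then show ?thesis using S[of i] i n by auto
      qed
    qed (use n in simp)
    have "closed_alternating R R' m y \<or> closed_alternating R' R m y"
      using y(1) shorter trans unfolding P_def by blast
    then have "\<bar>\<Sum>i<m. (- 1) ^ i * h (y i)\<bar> \<le> \<sigma> * real m"
      using less.IH[of m y] n by simp
    moreover have "(\<Sum>i<n. (- 1) ^ i * h (y i)) = (\<Sum>i<m. (- 1) ^ i * h (y i))"
      using n y(2) by simp
    moreover have "\<sigma> * real m \<le> \<sigma> * real n" using n \<sigma> by (intro mult_left_mono) auto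
    ultimately show ?thesis using y(1) by (simp add: P_def)
  qed
qed

lemma quot_proj_eq_iff: "quot_proj A a = quot_proj A b \<longleftrightarrow> (a, b) \<in> alg_rel A"
  unfolding quot_proj_def Equiv_Relations.proj_def alg_rel_def by auto

lemma nth_append_hd:
  assumes "i \<le> length xs" "xs \<noteq> []"
  shows "(xs @ [hd xs]) ! i = xs ! (i mod length xs)"
  using assms by (cases "i = length xs") (auto simp: nth_append hd_conv_nth)

text \<open>
  Closed bolts are the nonempty closed alternating sequences without consecutive repetitions, of
  either type.
\<close>

lemma closed_bolt_iff:
  "closed_bolt A1 A2 xs \<longleftrightarrow> xs \<noteq> [] \<and>
     (\<forall>i<length xs. xs ! i \<noteq> xs ! (Suc i mod length xs)) \<and>
     (closed_alternating (alg_rel A1) (alg_rel A2) (length xs) ((!) xs) \<or>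
      closed_alternating (alg_rel A2) (alg_rel A1) (length xs) ((!) xs))"
proof (cases "xs = []")
  case False
  have nth: "(xs @ [hd xs]) ! i = xs ! i" "(xs @ [hd xs]) ! Suc i = xs ! (Suc i mod length xs)"
    if "i < length xs" for i
    using that False nth_append_hd[of i xs] nth_append_hd[of "Suc i" xs] by auto
  show ?thesis
    unfolding closed_bolt_def finite_bolt_def alternates_def closed_alternating_def quot_proj_eq_iff
    using False by (auto simp: nth cong: if_cong)
qed (simp add: closed_bolt_def)

lemma closed_alternating_sum_zero:
  fixes \<phi> :: "'a \<Rightarrow> real"
  assumes x: "closed_alternating (fun_rel F) R' n x \<or> closed_alternating R' (fun_rel F) n x"
    and \<phi>: "\<phi> \<in> F"
  shows "(\<Sum>i<n. (- 1) ^ i * \<phi> (x i)) = 0"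
proof -
  have *: "(\<Sum>i<n. (- 1) ^ i * \<phi> (y i)) = 0" if y: "closed_alternating (fun_rel F) R' n y" for y
  proof (cases n)
    case (Suc m)
    then obtain k where n: "n = 2 * k + 2"
      using y by (auto simp: closed_alternating_def elim!: oddE)
    have "y \<in> alternating (fun_rel F) R' (2 * k + 1)"
      unfolding alternating_def
    proof (intro CollectI allI impI)
      fix i assume "i < 2 * k + 1"
      then show "(y i, y (Suc i)) \<in> (if even i then fun_rel F else R')"
        using y[unfolded closed_alternating_def, THEN conjunct2, rule_format, of i] by (simp add: n)
    qed
    then show ?thesis
      using alternating_sum_even_class[OF _ \<phi>] by (simp add: n lessThan_Suc_atMost[symmetric])
  qed simp
  show ?thesis
    using x
  proof
    assume x: "closed_alternating R' (fun_rel F) n x"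
    then have "even n" by (simp add: closed_alternating_def)
    then show ?thesis
      using *[OF closed_alternating_rotate[OF x]] by (simp add: alternating_sum_rotate)
  qed (rule *)
qed

lemma bolt_functional_le_approx_error:
  assumes l: "closed_bolt A1 A2 l" and ne: "A1 + A2 \<noteq> {}"
  shows "\<bar>bolt_functional l f\<bar> \<le> approx_error (A1 + A2) f"
  unfolding approx_error_def
proof (rule cINF_greatest[OF ne])
  fix u assume "u \<in> A1 + A2"
  then obtain u1 u2 where u: "u = u1 + u2" "u1 \<in> A1" "u2 \<in> A2" by (rule set_plus_elim)
  let ?n = "length l"
  let ?s = "\<lambda>g. \<Sum>i<?n. (- 1) ^ i * apply_bcontfun g (l ! i)"
  have n: "?n > 0" using l by (simp add: closed_bolt_iff)
  have "?s u1 = 0" "?s u2 = 0"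
    using closed_alternating_sum_zero[of "apply_bcontfun ` A1" "alg_rel A2" ?n "(!) l" "apply_bcontfun u1"]
      closed_alternating_sum_zero[of "apply_bcontfun ` A2" "alg_rel A1" ?n "(!) l" "apply_bcontfun u2"] l u
    by (auto simp: closed_bolt_iff alg_rel_eq_fun_rel)
  moreover have "?s (f - u) = ?s f - (?s u1 + ?s u2)"
    unfolding sum.distrib[symmetric] sum_subtractf[symmetric] u(1) by (simp add: algebra_simps)
  ultimately have "\<bar>?s f\<bar> = \<bar>?s (f - u)\<bar>" by simp
  also have "\<dots> \<le> (\<Sum>i<?n. \<bar>(- 1) ^ i * apply_bcontfun (f - u) (l ! i)\<bar>)"
    by (rule sum_abs)
  also have "\<dots> \<le> (\<Sum>i<?n. norm (f - u))"
    using norm_bounded[of "f - u"] by (intro sum_mono) (simp add: abs_mult)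
  finally have "\<bar>?s f\<bar> \<le> real ?n * norm (f - u)" by simp
  then show "\<bar>bolt_functional l f\<bar> \<le> norm (f - u)"
    using n by (simp add: bolt_functional_def abs_mult field_simps)
qed

lemma closed_alternating_sum_le:
  assumes bolts: "\<And>l. closed_bolt A1 A2 l \<Longrightarrow> \<bar>bolt_functional l f\<bar> \<le> \<sigma>" and "\<sigma> \<ge> 0"
    and x: "closed_alternating (alg_rel A1) (alg_rel A2) n x"
  shows "\<bar>\<Sum>i<n. (- 1) ^ i * apply_bcontfun f (x i)\<bar> \<le> \<sigma> * real n"
proof (rule closed_alternating_sum_bound[where R = "alg_rel A1" and R' = "alg_rel A2",
        OF _ _ _ \<open>\<sigma> \<ge> 0\<close>])
  show "trans (alg_rel A1)" "trans (alg_rel A2)"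
    by (auto simp: trans_def alg_rel_def)
  show "closed_alternating (alg_rel A1) (alg_rel A2) n x \<or> closed_alternating (alg_rel A2) (alg_rel A1) n x"
    using x by simp
  fix n and x :: "nat \<Rightarrow> 'a"
  assume n: "n > 0"
    and x: "closed_alternating (alg_rel A1) (alg_rel A2) n x \<or> closed_alternating (alg_rel A2) (alg_rel A1) n x"
    and distinct: "\<And>i. i < n \<Longrightarrow> x i \<noteq> x (Suc i mod n)"
  have nth: "map x [0..<n] ! i = x i" if "i < n" for i using that by simp
  have "closed_bolt A1 A2 (map x [0..<n])"
    unfolding closed_bolt_iff using n x distinct
    by (auto simp: closed_alternating_def cong: if_cong)
  moreover have "bolt_functional (map x [0..<n]) f = (\<Sum>i<n. (- 1) ^ i * apply_bcontfun f (x i)) / real n"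
    by (simp add: bolt_functional_def)
  ultimately show "\<bar>\<Sum>i<n. (- 1) ^ i * apply_bcontfun f (x i)\<bar> \<le> \<sigma> * real n"
    using bolts[of "map x [0..<n]"] n by (simp add: pos_divide_le_eq)
qed

section \<open>The formula for the approximation error\<close>

text \<open>
  The hard inequality. A long alternating sequence is closed by a connection whose length does not
  depend on it. The average over the closed sequence is at most \<open>\<sigma>\<close>, so the average over the long
  sequence exceeds \<open>\<sigma>\<close> by less than any prescribed \<open>e\<close>.
\<close>

lemma approx_error_le_bolt_bound:
  fixes A1 A2 :: "('a::metric_space \<Rightarrow>\<^sub>C real) set"
  assumes comp: "compact (UNIV :: 'a set)"
    and A1: "subalgebra_with_constants A1" "closed A1"
    and A2: "subalgebra_with_constants A2" "closed A2"
    and S: "closed (A1 + A2)" "subspace (A1 + A2)"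
    and bolts: "\<And>l. closed_bolt A1 A2 l \<Longrightarrow> \<bar>bolt_functional l f\<bar> \<le> \<sigma>" and \<sigma>: "\<sigma> \<ge> 0"
  shows "approx_error (A1 + A2) f \<le> \<sigma>"
proof (rule field_le_epsilon)
  fix e :: real assume e: "e > 0"
  let ?R1 = "alg_rel A1" and ?R2 = "alg_rel A2"
  note F1 = subalgebra_continuous_lattice[OF comp A1]
  note F2 = subalgebra_continuous_lattice[OF comp A2]
  obtain K where K: "\<And>k x u1 u2. x \<in> alternating ?R1 ?R2 (2 * k + 1) \<Longrightarrow> u1 \<in> A1 \<Longrightarrow> u2 \<in> A2 \<Longrightarrow>
      \<bar>apply_bcontfun u2 (x 0) - apply_bcontfun u2 (x (2 * k + 1))\<bar> \<le> K * norm (u1 + u2)"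
    using closed_sum_imp_end_difference_bound[OF S] by blast
  obtain k0 :: nat where k0: "4 * max K 0 < real k0" using reals_Archimedean2 by blast
  then have "k0 > 0" by (intro Nat.gr0I) auto
  have exchange: "\<exists>z\<in>alternating ?R2 ?R1 (2 * k + 1). z 0 = x 0 \<and> z (2 * k + 1) = x (2 * k + 1)"
    if "k0 \<le> k" and x: "x \<in> alternating ?R1 ?R2 (2 * k + 1)" for k x
    unfolding alg_rel_eq_fun_rel
  proof (rule alternating_exchange[OF comp F1 F2])
    show "4 * max K 0 < real (k + 1)" using k0 that by simp
    fix \<phi> \<phi>' B
    assume "\<phi> \<in> apply_bcontfun ` A1" "\<phi>' \<in> apply_bcontfun ` A2" and B: "\<And>x. \<bar>\<phi>' x - \<phi> x\<bar> \<le> B"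
    then obtain u1 u2 where u: "u1 \<in> A1" "u2 \<in> A2" "\<phi> = apply_bcontfun u1" "\<phi>' = apply_bcontfun u2"
      by auto
    have "- u1 \<in> A1" using A1(1) u(1) by (simp add: subalgebra_with_constants_def subspace_neg)
    then have "\<bar>\<phi>' (x 0) - \<phi>' (x (2 * k + 1))\<bar> \<le> K * norm (- u1 + u2)"
      using K[OF x _ u(2), of "- u1"] u by simp
    also have "\<dots> \<le> max K 0 * norm (- u1 + u2)"
      by (intro mult_right_mono) auto
    also have "\<dots> \<le> max K 0 * B"
      using B u by (intro mult_left_mono norm_bound) auto
    finally show "\<bar>\<phi>' (x 0) - \<phi>' (x (2 * k + 1))\<bar> \<le> max K 0 * B" .
  qed
  have R2: "refl ?R2" "trans ?R2"
    by (auto simp: refl_on_def trans_def alg_rel_def)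
  \<comment> \<open>The connection has 2 * k0 inner points; k is chosen so that their contribution is
     negligible against the long sequence of 2 * (k + 1) points.\<close>
  obtain k1 :: nat where k1: "real k0 * (\<sigma> + norm f) / e < real k1" using reals_Archimedean2 by blast
  define k where "k = max k0 k1"
  have "real k0 * (\<sigma> + norm f) < real (k + 1) * e"
  proof -
    have "real k0 * (\<sigma> + norm f) < real k1 * e" using k1 e by (simp add: field_simps)
    also have "\<dots> \<le> real (k + 1) * e" using e by (simp add: k_def)
    finally show ?thesis .
  qed
  then have large: "2 * real k0 * (\<sigma> + norm f) < 2 * real (k + 1) * e" by linarith
  have "(\<Sum>i\<le>2 * k + 1. (- 1) ^ i * apply_bcontfun f (x i)) < 2 * real (k + 1) * (\<sigma> + e)"
    if x: "x \<in> alternating ?R1 ?R2 (2 * k + 1)" for x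
  proof -
    have "k0 \<le> k" by (simp add: k_def)
    obtain z where z: "z \<in> alternating ?R2 ?R1 (2 * k + 1)" "z 0 = x 0" "z (2 * k + 1) = x (2 * k + 1)"
      using exchange[OF \<open>k0 \<le> k\<close> x] by blast
    then obtain y where y: "y \<in> alternating ?R2 ?R1 (2 * k0 + 1)" "y 0 = x 0"
        "y (2 * k0 + 1) = x (2 * k + 1)"
      using alternating_shorten[OF exchange R2 \<open>k0 \<le> k\<close> z(1)] by auto
    \<comment> \<open>The sequence w runs through x and returns along the connection y backwards.\<close>
    define n where "n = 2 * (k + 1) + 2 * k0"
    define w where "w i = (if i \<le> 2 * k + 1 then x i else y (n - i))" for i
    have w_y: "w i = y (n - i)" if "2 * k + 1 \<le> i" for i
      using that y(3) by (cases "i = 2 * k + 1") (auto simp: w_def n_def)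
    have sym: "(b, a) \<in> alg_rel A \<longleftrightarrow> (a, b) \<in> alg_rel A" for A :: "('a \<Rightarrow>\<^sub>C real) set" and a b
      by (auto simp: alg_rel_def)
    have "closed_alternating ?R1 ?R2 n w"
      unfolding closed_alternating_def
    proof (intro conjI allI impI)
      show "even n" by (simp add: n_def)
      fix i assume i: "i < n"
      show "(w i, w (Suc i mod n)) \<in> (if even i then ?R1 else ?R2)"
      proof (cases "i \<le> 2 * k")
        case True
        then show ?thesis
          using alternatingD[OF x, of i] \<open>k0 > 0\<close> by (auto simp: w_def n_def)
      next
        case False
        then have "w i = y (Suc (n - Suc i))" using i by (simp add: w_y Suc_diff_Suc)
        moreover have "w (Suc i mod n) = y (n - Suc i)"
          using False i y(2) by (cases "Suc i = n") (auto simp: w_y, simp add: w_def)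
        moreover have "n - Suc i < 2 * k0 + 1" using False by (simp add: n_def)
        moreover have "even (n - Suc i) \<longleftrightarrow> odd i" using i \<open>even n\<close> by simp
        ultimately show ?thesis
          using alternatingD[OF y(1), of "n - Suc i"] sym by (auto split: if_splits)
      qed
    qed
    then have "\<bar>\<Sum>i<n. (- 1) ^ i * apply_bcontfun f (w i)\<bar> \<le> \<sigma> * real n"
      using bolts by (intro closed_alternating_sum_le[OF _ \<sigma>])
    moreover have "(\<Sum>i<n. (- 1) ^ i * apply_bcontfun f (w i)) =
        (\<Sum>i\<le>2 * k + 1. (- 1) ^ i * apply_bcontfun f (x i)) +
        (\<Sum>i\<in>{2 * k + 2..<n}. (- 1) ^ i * apply_bcontfun f (w i))"
    proof -
      let ?g = "\<lambda>i. (- 1) ^ i * apply_bcontfun f (w i)"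
      have "sum ?g {0..<2 * k + 2} + sum ?g {2 * k + 2..<n} = sum ?g {0..<n}"
        by (rule sum.atLeastLessThan_concat) (simp_all add: n_def)
      moreover have "{0..<2 * k + 2} = {..2 * k + 1}" by auto
      moreover have "sum ?g {..2 * k + 1} = (\<Sum>i\<le>2 * k + 1. (- 1) ^ i * apply_bcontfun f (x i))"
        by (rule sum.cong) (simp_all add: w_def)
      ultimately show ?thesis by (simp only: lessThan_atLeast0)
    qed
    moreover have "\<bar>\<Sum>i\<in>{2 * k + 2..<n}. (- 1) ^ i * apply_bcontfun f (w i)\<bar> \<le> 2 * real k0 * norm f"
    proof -
      have "\<bar>\<Sum>i\<in>{2 * k + 2..<n}. (- 1) ^ i * apply_bcontfun f (w i)\<bar> \<le>
          (\<Sum>i\<in>{2 * k + 2..<n}. norm f)"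
        using norm_bounded[of f]
        by (intro order.trans[OF sum_abs] sum_mono) (simp add: abs_mult)
      then show ?thesis by (simp add: n_def)
    qed
    moreover have "\<sigma> * real n = 2 * real (k + 1) * \<sigma> + 2 * real k0 * \<sigma>"
      by (simp add: n_def algebra_simps)
    ultimately have "(\<Sum>i\<le>2 * k + 1. (- 1) ^ i * apply_bcontfun f (x i)) \<le>
        2 * real (k + 1) * \<sigma> + 2 * real k0 * (\<sigma> + norm f)"
      by (simp only: distrib_left)
    then show ?thesis using large by (simp only: distrib_left)
  qed
  then show "approx_error (A1 + A2) f \<le> \<sigma> + e"
    by (rule approx_error_le_alternating_average[OF comp A1 A2])
qed

lemma proximinal_imp_closed:
  assumes "proximinal S"
  shows "closed S"
proof -
  have "e \<in> S" if "e \<in> closure S" for e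
  proof -
    obtain f0 where f0: "f0 \<in> S" "norm (e - f0) = (INF g\<in>S. norm (e - g))"
      using assms by (auto simp: proximinal_def)
    have "norm (e - f0) < \<epsilon>" if \<epsilon>: "\<epsilon> > 0" for \<epsilon>
    proof -
      obtain g where g: "g \<in> S" "dist g e < \<epsilon>"
        using \<open>e \<in> closure S\<close> \<epsilon> by (auto simp: closure_approachable)
      then have "norm (e - f0) \<le> norm (e - g)"
        using approx_error_le_norm[OF g(1), of e] f0(2) by (simp add: approx_error_def)
      then show ?thesis using g(2) by (simp add: dist_norm norm_minus_commute)
    qed
    then have "norm (e - f0) \<le> 0" by (meson field_le_epsilon less_imp_le linorder_not_less less_irrefl)
    then show ?thesis using f0(1) by simp
  qed
  then show ?thesis by (metis closure_subset closure_eq subsetI subset_antisym)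
qed

theorem theorem2p3:
  fixes A1 A2 :: "('a::metric_space \<Rightarrow>\<^sub>C real) set"
  assumes "compact (UNIV :: 'a set)"
    and "subalgebra_with_constants A1" and "closed A1"
    and "subalgebra_with_constants A2" and "closed A2"
    and "proximinal (A1 + A2)"
  shows "\<forall>f. f \<notin> A1 + A2 \<longrightarrow>
    ereal (approx_error (A1 + A2) f) =
      (SUP l\<in>{l. closed_bolt A1 A2 l}. ereal \<bar>bolt_functional l f\<bar>)"
proof (intro allI impI)
  fix f assume f: "f \<notin> A1 + A2"
  let ?E = "approx_error (A1 + A2) f"
  let ?sup = "SUP l\<in>{l. closed_bolt A1 A2 l}. ereal \<bar>bolt_functional l f\<bar>"
  have S: "closed (A1 + A2)" "subspace (A1 + A2)"
    using assms(6) proximinal_imp_closed by (auto simp: proximinal_def)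
  obtain u0 where "u0 \<in> A1 + A2" "norm (f - u0) = ?E"
    using assms(6) by (auto simp: proximinal_def approx_error_def)
  then have E: "?E > 0" using f by (metis right_minus_eq zero_less_norm_iff)
  show "ereal ?E = ?sup"
  proof (rule antisym)
    show "?sup \<le> ereal ?E"
      using bolt_functional_le_approx_error[of A1 A2 _ f] \<open>u0 \<in> A1 + A2\<close>
      by (intro SUP_least) auto
    show "ereal ?E \<le> ?sup"
    proof (rule ccontr)
      assume "\<not> ereal ?E \<le> ?sup"
      \<comment> \<open>The maximum with 0 covers the case without closed bolts, where the supremum is - \<infinity>.\<close>
      then have "max 0 ?sup < ereal ?E" using E by simp
      then obtain c where c: "max 0 ?sup < c" "c < ereal ?E" using dense by blast
      then obtain \<sigma> where \<sigma>: "c = ereal \<sigma>" by (cases c) auto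
      have "\<bar>bolt_functional l f\<bar> \<le> \<sigma>" if "closed_bolt A1 A2 l" for l
      proof -
        have "ereal \<bar>bolt_functional l f\<bar> \<le> ?sup" using that by (intro SUP_upper) simp
        also have "\<dots> \<le> ereal \<sigma>"
          using c(1) unfolding \<sigma> by (meson less_imp_le max_less_iff_conj)
        finally show ?thesis by simp
      qed
      moreover have "\<sigma> \<ge> 0" using c(1) \<sigma> by simp
      ultimately have "?E \<le> \<sigma>"
        using approx_error_le_bolt_bound[OF assms(1-5) S] by blast
      then show False using c(2) \<sigma> by simp
    qed
  qed
qed

end
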